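(* Let $\nabla\subset N_{\mathbb R}\simeq\mathbb{R}^n$ be a minimal polyhedron with vertices $V_1,\dots,V_k$ and let $\mathbf q=(q_i^{(j)})$ be a combined weight system corresponding to an IP simplex structure of $\nabla$. Then: a) The map $M_{\mathbb R}\to\mathbb{R}^k$, $X\mapsto\mathbf x=(x_1,\dots,x_k)$ with $x_i=\langle V_i,X\rangle$, defines an embedding such that the image of $M_{\mathbb R}$ is the subspace defined by $\sum_iq_i^{(j)}x_i=0$ for all $j$. b) $\nabla^*$ is isomorphic to the polyhedron defined in this subspace by $x_i\ge-1$ for $i=1,\dots,k$. c) If $\mathbf q$ is rational, then $M_{\rm finest}$ is isomorphic to the sublattice of $\mathbb{Z}^k=\{(x_1,\dots,x_k)\text{ integer}\}\subset\mathbb{R}^k$ determined by the equations $\sum_iq_i^{(j)}x_i=0$ for all $j$.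
   Context: $M_{\mathbb R}$ and $N_{\mathbb R}$ are dual $n$-dimensional real vector spaces with pairing $\langle\cdot,\cdot\rangle$. A polytope (= polyhedron) is the convex hull of finitely many points; it has the IP property if the origin $\mathbf 0$ is in its interior (for a lower dimensional polytope: interior relative to its linear span). The dual of $\nabla\subset N_{\mathbb R}$ is $\nabla^*=\{x\in M_{\mathbb R}:\langle y,x\rangle\ge-1\ \forall y\in\nabla\}$. A minimal polytope is a polytope with the IP property such that removing any vertex and taking the convex hull of the remaining vertices destroys the IP property. An IP simplex is a simplex with the IP property. An IP simplex structure of an $n$-dimensional minimal polytope $\nabla$ with $k$ vertices is a collection of subsets $S_j$, $1\le j\le k-n$, of its vertex set such that each $\mathrm{conv}\,S_j$ is an IP simplex, each $\mathrm{conv}\bigcup_{i\le j}S_i$ is a (possibly lower dimensional) minimal polytope, $\mathrm{conv}\bigcup_{i\le k-n}S_i=\nabla$, and $S_j\setminus\bigcup_{i<j}S_i$ contains at least two vertices. The corresponding combined weight system consists of the numbers $q_i^{(j)}$ with $q_i^{(j)}>0$ if $V_i\in S_j$, $q_i^{(j)}=0$ if $V_i\notin S_j$, $\sum_iq_i^{(j)}V_i=0$ and $\sum_iq_i^{(j)}=1$. It is rational if all $q_i^{(j)}$ are rational. $N_{\rm coarsest}$ is the lattice in $N_{\mathbb R}$ generated over $\mathbb{Z}$ by the vertices of $\nabla$, and $M_{\rm finest}\subset M_{\mathbb R}$ is the lattice dual to $N_{\rm coarsest}$. *)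

theory Defs
  imports "HOL-Analysis.Analysis" "HOL-Computational_Algebra.Group_Closure"
begin

text \<open>
  The dual real vector spaces \<open>N\<close> and \<open>M\<close> are two types \<open>'a\<close> and \<open>'b\<close>; the pairing identifies
  \<open>M\<close> with the space of all linear functionals on \<open>N\<close>. The inner products of \<open>'a\<close> and \<open>'b\<close> play
  no role beyond inducing the canonical topology of a finite-dimensional space.
\<close>
definition dual_pairing ::
    "('a::euclidean_space \<Rightarrow> 'b::euclidean_space \<Rightarrow> real) \<Rightarrow> bool"
  where "dual_pairing p \<longleftrightarrow>
    bilinear p \<and> bij_betw (\<lambda>x y. p y x) UNIV {f :: 'a \<Rightarrow> real. linear f}"

definition vertices :: "'a::real_vector set \<Rightarrow> 'a set"
  where "vertices P = {v. v extreme_point_of P}"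

text \<open>The interior is taken relative to the linear (not the affine) span.\<close>
definition IP :: "'a::euclidean_space set \<Rightarrow> bool"
  where "IP P \<longleftrightarrow> polytope P \<and> 0 \<in> top_of_set (span P) interior_of P"

definition minimal_polytope :: "'a::euclidean_space set \<Rightarrow> bool"
  where "minimal_polytope P \<longleftrightarrow>
    IP P \<and> (\<forall>v\<in>vertices P. \<not> IP (convex hull (vertices P - {v})))"

definition IP_simplex :: "'a::euclidean_space set \<Rightarrow> bool"
  where "IP_simplex P \<longleftrightarrow> (\<exists>d. d simplex P) \<and> IP P"

text \<open>
  The number of simplices, (number of vertices) minus dimension. The truncated subtraction is
  harmless: a \<open>d\<close>-dimensional polytope has at least \<open>d + 1\<close> vertices.
\<close>
definition simplex_count :: "'a::euclidean_space set \<Rightarrow> nat"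
  where "simplex_count P = card (vertices P) - nat (aff_dim P)"

definition IP_simplex_structure :: "'a::euclidean_space set \<Rightarrow> (nat \<Rightarrow> 'a set) \<Rightarrow> bool"
  where "IP_simplex_structure P S \<longleftrightarrow>
    minimal_polytope P \<and>
    (\<forall>j\<in>{1..simplex_count P}.
       S j \<subseteq> vertices P \<and>
       IP_simplex (convex hull (S j)) \<and>
       minimal_polytope (convex hull (\<Union>i\<in>{1..j}. S i)) \<and>
       card (S j - (\<Union>i\<in>{1..<j}. S i)) \<ge> 2) \<and>
    convex hull (\<Union>i\<in>{1..simplex_count P}. S i) = P"

text \<open>
  The vertices are indexed by a finite type \<open>'k\<close> instead of the numbers \<open>1, \<dots>, k\<close>;
  \<open>q i j\<close> is the weight of the vertex \<open>V i\<close> in the \<open>j\<close>-th simplex.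
\<close>
definition combined_weight_system ::
    "('k::finite \<Rightarrow> 'a::euclidean_space) \<Rightarrow> (nat \<Rightarrow> 'a set) \<Rightarrow> nat \<Rightarrow> ('k \<Rightarrow> nat \<Rightarrow> real) \<Rightarrow> bool"
  where "combined_weight_system V S m q \<longleftrightarrow>
    (\<forall>j\<in>{1..m}.
       (\<forall>i. V i \<in> S j \<longrightarrow> q i j > 0) \<and>
       (\<forall>i. V i \<notin> S j \<longrightarrow> q i j = 0) \<and>
       (\<Sum>i\<in>UNIV. q i j *\<^sub>R V i) = 0 \<and>
       (\<Sum>i\<in>UNIV. q i j) = 1)"

definition weight_space :: "nat \<Rightarrow> ('k::finite \<Rightarrow> nat \<Rightarrow> real) \<Rightarrow> (real ^ 'k) set"
  where "weight_space m q = {x. \<forall>j\<in>{1..m}. (\<Sum>i\<in>UNIV. q i j * x $ i) = 0}"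

definition dual_polytope :: "('a \<Rightarrow> 'b \<Rightarrow> real) \<Rightarrow> 'a set \<Rightarrow> 'b set"
  where "dual_polytope p P = {x. \<forall>y\<in>P. p y x \<ge> -1}"

definition is_lattice :: "'a::euclidean_space set \<Rightarrow> bool"
  where "is_lattice L \<longleftrightarrow>
    0 \<in> L \<and> (\<forall>x\<in>L. \<forall>y\<in>L. x - y \<in> L) \<and> discrete L \<and> span L = UNIV"

definition N_coarsest :: "'a::euclidean_space set \<Rightarrow> 'a set"
  where "N_coarsest P = group_closure (vertices P)"

definition M_finest :: "('a::euclidean_space \<Rightarrow> 'b \<Rightarrow> real) \<Rightarrow> 'a set \<Rightarrow> 'b set"
  where "M_finest p P = {x. \<forall>y\<in>N_coarsest P. p y x \<in> \<int>}"

definition vertex_map ::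
    "('a \<Rightarrow> 'b \<Rightarrow> real) \<Rightarrow> ('k::finite \<Rightarrow> 'a) \<Rightarrow> 'b \<Rightarrow> real ^ 'k"
  where "vertex_map p V X = (\<chi> i. p (V i) X)"

end

theory Submission
  imports Defs
begin

text \<open>
  The vertices span \<open>N\<close>, so the vertex map is injective and its image has dimension
  \<open>n = DIM('a)\<close>. Every weight vector is a linear relation between the vertices, so the image lies
  in the weight space. Since each simplex contains a vertex that belongs to no earlier simplex, the
  weight vectors are in echelon form, hence independent; the space that they cut out of
  \<open>\<real>\<^sup>k\<close> has dimension \<open>k - (k - n) = n\<close> and therefore is the image.
  These are \<open>independent_echelon\<close> and \<open>range_evaluation_map\<close>.

  The conditions \<open>x\<^sub>i \<ge> -1\<close> describe the dual polytope because a polytope is the convex hull of its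
  vertices. The solution set is bounded because the simplices cover all the vertices: the sum of
  all the weight vectors has only positive entries, and a positive linear relation turns lower
  bounds on the coordinates into upper bounds.

  For the lattices, the point is that a rational linear system has enough integral solutions to
  span its real solution space (\<open>span_integral_solutions\<close>). Thus the functionals that are
  integral on the vertices span \<open>M\<close>. A set on which finitely many functionals that jointly separate
  points take integral values is discrete (\<open>discrete_if_integral\<close>), and this applies to both
  lattices, each of which provides such functionals on the other. Rationality
  enters only here; the group generated by the vertices is not discrete if some weight is
  irrational.
\<close>

section \<open>Linear systems in echelon form\<close>

text \<open>
  Each vector has a nonzero coordinate at which all its predecessors vanish, so it is not in their
  span.
\<close>
lemma independent_echelon:
  fixes w :: "nat \<Rightarrow> real ^ 'k::finite"
  assumes "\<forall>j\<in>{1..m}. \<exists>i. w j $ i \<noteq> 0 \<and> (\<forall>l\<in>{1..<j}. w l $ i = 0)"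
  shows "independent (w ` {1..m}) \<and> card (w ` {1..m}) = m"
  using assms
proof (induction m)
  case 0
  have "w ` {1..0} = {}" by simp
  then show ?case by (metis card.empty independent_empty)
next
  case (Suc m)
  have "\<forall>j\<in>{1..m}. \<exists>i. w j $ i \<noteq> 0 \<and> (\<forall>l\<in>{1..<j}. w l $ i = 0)"
    by (intro ballI bspec[OF Suc.prems]) simp
  then have IH: "independent (w ` {1..m})" "card (w ` {1..m}) = m"
    using Suc.IH by blast+
  obtain i where i: "w (Suc m) $ i \<noteq> 0" "\<forall>l\<in>{1..m}. w l $ i = 0"
  proof -
    have "\<exists>i. w (Suc m) $ i \<noteq> 0 \<and> (\<forall>l\<in>{1..<Suc m}. w l $ i = 0)"
      by (rule bspec[OF Suc.prems]) simp
    then show thesis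
      using that unfolding atLeastLessThanSuc_atLeastAtMost by blast
  qed
  have "subspace {x :: real ^ 'k. x $ i = 0}"
    by (auto simp: subspace_def)
  then have "span (w ` {1..m}) \<subseteq> {x. x $ i = 0}"
    using i(2) by (intro span_minimal) auto
  then have new: "w (Suc m) \<notin> span (w ` {1..m})"
    using i(1) by auto
  then have notin: "w (Suc m) \<notin> w ` {1..m}"
    using span_base[of "w (Suc m)"] by metis
  have eq: "w ` {1..Suc m} = insert (w (Suc m)) (w ` {1..m})"
    by (simp add: atLeastAtMostSuc_conv)
  have "independent (w ` {1..Suc m})"
    unfolding eq using new IH(1) by (rule independent_insertI)
  moreover have "card (w ` {1..Suc m}) = Suc m"
    unfolding eq using notin IH(2) by (subst card_insert_disjoint) auto
  ultimately show ?case ..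
qed

text \<open>
  The image lies in the solution space, and both have dimension \<open>DIM('a)\<close>: the image because
  evaluation at a spanning set is injective, the solution space by the independence of its
  equations.
\<close>
lemma range_evaluation_map:
  fixes V :: "'k::finite \<Rightarrow> 'a::euclidean_space" and w :: "nat \<Rightarrow> real ^ 'k"
  assumes spanV: "span (range V) = UNIV"
    and rel: "\<forall>j\<in>{1..m}. (\<Sum>i\<in>UNIV. (w j $ i) *\<^sub>R V i) = 0"
    and echelon: "\<forall>j\<in>{1..m}. \<exists>i. w j $ i \<noteq> 0 \<and> (\<forall>l\<in>{1..<j}. w l $ i = 0)"
    and m: "m = CARD('k) - DIM('a)"
  shows "range (\<lambda>y. \<chi> i. V i \<bullet> y) = {x. \<forall>j\<in>{1..m}. w j \<bullet> x = 0}"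
    (is "range ?U = ?W")
proof -
  have linU: "linear ?U"
    by (intro linearI) (auto simp: vec_eq_iff inner_add_right)
  have "y = 0" if "?U y = 0" for y
  proof -
    have "V i \<bullet> y = 0" for i
      using that by (simp add: vec_eq_iff)
    then have "range V \<subseteq> {v. v \<bullet> y = 0}"
      by auto
    moreover have "subspace {v. v \<bullet> y = 0}"
      by (auto simp: subspace_def inner_add_left)
    ultimately have "span (range V) \<subseteq> {v. v \<bullet> y = 0}"
      by (rule span_minimal)
    then have "y \<bullet> y = 0"
      using spanV by blast
    then show "y = 0"
      by simp
  qed
  then have injU: "inj ?U"
    using linU linear_injective_0 by blast
  have dimU: "dim (range ?U) = DIM('a)"
    using dim_image_eq[OF linU, of UNIV] injU by simp
  then have le: "DIM('a) \<le> CARD('k)"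
    using dim_subset_UNIV[of "range ?U"] by simp
  have "w j \<bullet> ?U y = 0" if "j \<in> {1..m}" for j y
  proof -
    have "w j \<bullet> ?U y = (\<Sum>i\<in>UNIV. (w j $ i) *\<^sub>R V i) \<bullet> y"
      by (simp add: inner_vec_def inner_sum_left)
    then show ?thesis
      using rel that by simp
  qed
  then have sub: "range ?U \<subseteq> ?W"
    by auto
  have subW: "subspace ?W"
    by (auto simp: subspace_def inner_add_right)
  have "?W = {y \<in> UNIV. \<forall>x\<in>span (w ` {1..m}). orthogonal x y}"
  proof (intro subset_antisym subsetI)
    fix y assume "y \<in> ?W"
    then have "orthogonal y x" if "x \<in> span (w ` {1..m})" for x
      by (intro orthogonal_to_span[OF that]) (auto simp: orthogonal_def inner_commute)
    then show "y \<in> {y \<in> UNIV. \<forall>x\<in>span (w ` {1..m}). orthogonal x y}"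
      by (simp add: orthogonal_commute)
  next
    fix y assume "y \<in> {y \<in> UNIV. \<forall>x\<in>span (w ` {1..m}). orthogonal x y}"
    then show "y \<in> ?W"
      by (auto simp: orthogonal_def intro: span_base)
  qed
  then have "dim ?W + dim (span (w ` {1..m})) = dim (UNIV :: (real ^ 'k) set)"
    using dim_subspace_orthogonal_to_vectors[of "span (w ` {1..m})" UNIV] by simp
  moreover have "dim (span (w ` {1..m})) = m"
    using independent_echelon[OF echelon] by (simp add: dim_span dim_eq_card_independent)
  ultimately have "dim ?W \<le> dim (range ?U)"
    using m le dimU by simp
  then show ?thesis
    using subspace_dim_equal[OF linear_subspace_image[OF linU subspace_UNIV] subW sub] by simp
qed

section \<open>Integral solutions of rational linear systems\<close>

lemma ex_integral_multiple:
  fixes x :: "real ^ 'k::finite"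
  assumes "\<forall>i. x $ i \<in> \<rat>"
  obtains c :: real where "c \<noteq> 0" "\<forall>i. (c *\<^sub>R x) $ i \<in> \<int>"
proof -
  have "\<exists>d::real. d \<noteq> 0 \<and> d \<in> \<int> \<and> d * x $ i \<in> \<int>" for i
  proof -
    obtain a b where "b \<noteq> 0" "x $ i = of_int a / of_int b"
      using assms by (metis Rats_cases' less_irrefl)
    then show ?thesis
      by (intro exI[of _ "of_int b"]) simp
  qed
  then obtain d :: "'k \<Rightarrow> real" where d: "\<And>i. d i \<noteq> 0" "\<And>i. d i \<in> \<int>" "\<And>i. d i * x $ i \<in> \<int>"
    by metis
  have "prod d UNIV * x $ i \<in> \<int>" for i
  proof -
    have "prod d UNIV = d i * prod d (UNIV - {i})"
      by (rule prod.remove) auto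
    then have eq: "prod d UNIV * x $ i = prod d (UNIV - {i}) * (d i * x $ i)"
      by (metis mult.assoc mult.commute)
    have "prod d (UNIV - {i}) \<in> \<int>"
      by (rule Ints_prod) (rule d(2))
    then show ?thesis
      unfolding eq by (rule Ints_mult) (rule d(3))
  qed
  moreover have "prod d UNIV \<noteq> 0"
    using d(1) by simp
  ultimately show thesis
    using that[of "prod d UNIV"] by simp
qed

text \<open>
  The equations are imposed one at a time. If a rational solution \<open>b\<close> of the earlier equations
  violates the new equation, then the projection along \<open>b\<close> onto the hyperplane of the new equation
  has rational coefficients; it maps the old solution space onto the new one and rational
  points to rational points, so spanning is preserved. If there is no such \<open>b\<close>, the new equation
  follows from the old ones.
\<close>
lemma span_rational_solutions:
  fixes w :: "nat \<Rightarrow> real ^ 'k::finite"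
  assumes "\<forall>j\<in>{1..m}. \<forall>i. w j $ i \<in> \<rat>"
  shows "{x. \<forall>j\<in>{1..m}. w j \<bullet> x = 0} \<subseteq>
    span {x. (\<forall>j\<in>{1..m}. w j \<bullet> x = 0) \<and> (\<forall>i. x $ i \<in> \<rat>)}"
  using assms
proof (induction m)
  case 0
  have "Basis \<subseteq> {x :: real ^ 'k. \<forall>i. x $ i \<in> \<rat>}"
    by (auto simp: Basis_vec_def axis_def)
  then have "span Basis \<subseteq> span {x :: real ^ 'k. \<forall>i. x $ i \<in> \<rat>}"
    by (rule span_mono)
  then show ?case by (simp add: subset_iff)
next
  case (Suc m)
  let ?W = "\<lambda>m. {x. \<forall>j\<in>{1..m}. w j \<bullet> x = 0}"
  let ?R = "\<lambda>m. {x. (\<forall>j\<in>{1..m}. w j \<bullet> x = 0) \<and> (\<forall>i. x $ i \<in> \<rat>)}"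
  define v where "v = w (Suc m)"
  have IH: "?W m \<subseteq> span (?R m)"
    using Suc by auto
  have rat: "v \<bullet> x \<in> \<rat>" if "\<forall>i. x $ i \<in> \<rat>" for x
    using Suc.prems that unfolding inner_vec_def v_def
    by (intro Rats_sum) auto
  have split: "x \<in> ?W (Suc m) \<longleftrightarrow> x \<in> ?W m \<and> v \<bullet> x = 0" for x
    by (auto simp: atLeastAtMostSuc_conv v_def)
  have splitR: "x \<in> ?R (Suc m) \<longleftrightarrow> x \<in> ?R m \<and> v \<bullet> x = 0" for x
    by (auto simp: atLeastAtMostSuc_conv v_def)
  show ?case
  proof (cases "\<forall>b\<in>?R m. v \<bullet> b = 0")
    case True
    then have "?R (Suc m) = ?R m"
      using splitR by blast
    then show ?thesis
      using IH split by (metis (no_types, lifting) subset_iff)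
  next
    case False
    then obtain b where b: "b \<in> ?R m" "v \<bullet> b \<noteq> 0"
      by blast
    define f where "f x = x - ((v \<bullet> x) / (v \<bullet> b)) *\<^sub>R b" for x
    have lin: "linear f"
      unfolding f_def
      by (intro linearI) (auto simp: inner_add_right algebra_simps add_divide_distrib)
    have fR: "f ` ?R m \<subseteq> ?R (Suc m)"
    proof
      fix y assume "y \<in> f ` ?R m"
      then obtain x where x: "x \<in> ?R m" "y = f x"
        by blast
      have "(v \<bullet> x) / (v \<bullet> b) \<in> \<rat>"
        using rat x(1) b(1) by simp
      then have "x $ i - (v \<bullet> x) / (v \<bullet> b) * b $ i \<in> \<rat>" for i
        using x(1) b(1) by (intro Rats_diff[OF _ Rats_mult]) auto
      then have "\<forall>i. y $ i \<in> \<rat>"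
        using x(2) by (simp add: f_def)
      then have "y \<in> ?R m"
        using x b(1) by (simp add: f_def inner_diff_right)
      moreover have "v \<bullet> y = 0"
        using x(2) b(2) by (simp add: f_def inner_diff_right)
      ultimately show "y \<in> ?R (Suc m)"
        using splitR by blast
    qed
    show ?thesis
    proof
      fix x assume x: "x \<in> ?W (Suc m)"
      then have "f x = x"
        using split by (simp add: f_def)
      moreover have "f x \<in> f ` span (?R m)"
        using x split IH by blast
      ultimately have "x \<in> span (f ` ?R m)"
        using linear_span_image[OF lin] by metis
      then show "x \<in> span (?R (Suc m))"
        using span_mono[OF fR] by blast
    qed
  qed
qed

lemma span_integral_solutions:
  fixes w :: "nat \<Rightarrow> real ^ 'k::finite"
  assumes "\<forall>j\<in>{1..m}. \<forall>i. w j $ i \<in> \<rat>"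
  shows "{x. \<forall>j\<in>{1..m}. w j \<bullet> x = 0} \<subseteq>
    span {x. (\<forall>j\<in>{1..m}. w j \<bullet> x = 0) \<and> (\<forall>i. x $ i \<in> \<int>)}" (is "_ \<subseteq> span ?Z")
proof -
  have "{x. (\<forall>j\<in>{1..m}. w j \<bullet> x = 0) \<and> (\<forall>i. x $ i \<in> \<rat>)} \<subseteq> span ?Z"
  proof
    fix x assume x: "x \<in> {x. (\<forall>j\<in>{1..m}. w j \<bullet> x = 0) \<and> (\<forall>i. x $ i \<in> \<rat>)}"
    then obtain c where c: "c \<noteq> 0" "\<forall>i. (c *\<^sub>R x) $ i \<in> \<int>"
      using ex_integral_multiple[of x] by blast
    have "c *\<^sub>R x \<in> span ?Z"
      using x c(2) by (intro span_base) simp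
    then have "(1 / c) *\<^sub>R (c *\<^sub>R x) \<in> span ?Z"
      by (rule span_scale)
    then show "x \<in> span ?Z"
      using c(1) by simp
  qed
  then have "span {x. (\<forall>j\<in>{1..m}. w j \<bullet> x = 0) \<and> (\<forall>i. x $ i \<in> \<rat>)} \<subseteq> span ?Z"
    by (intro span_minimal) auto
  then show ?thesis
    using span_rational_solutions[OF assms] by blast
qed

section \<open>Discreteness and boundedness\<close>

text \<open>
  A neighbourhood of a point on which all the functionals vary by less than \<open>1\<close> contains no other
  point of the set.
\<close>
lemma discrete_if_integral:
  fixes L :: "'a::euclidean_space set"
  assumes "finite F" and lin: "\<And>f. f \<in> F \<Longrightarrow> linear f"
    and int: "\<And>f x. f \<in> F \<Longrightarrow> x \<in> L \<Longrightarrow> (f x :: real) \<in> \<int>"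
    and sep: "\<And>x. (\<And>f. f \<in> F \<Longrightarrow> f x = 0) \<Longrightarrow> x = 0"
  shows "discrete L"
proof (rule discreteI)
  fix x assume x: "x \<in> L"
  let ?T = "\<Inter>f\<in>F. {y. \<bar>f y - f x\<bar> < 1}"
  have "open ?T"
  proof (rule open_INT[OF \<open>finite F\<close>], rule ballI)
    fix f assume "f \<in> F"
    then have "continuous_on UNIV f"
      using lin linear_continuous_on linear_linear by blast
    then show "open {y. \<bar>f y - f x\<bar> < 1}"
      by (intro open_Collect_less continuous_intros)
  qed
  moreover have "y = x" if "y \<in> ?T" "y \<in> L" for y
  proof -
    have "f (y - x) = 0" if "f \<in> F" for f
    proof -
      have "f y = f x"
        using Ints_eq_abs_less1[OF int int] \<open>y \<in> ?T\<close> \<open>y \<in> L\<close> x that by auto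
      then show ?thesis
        using linear_diff[OF lin[OF that]] by simp
    qed
    then show ?thesis
      using sep[of "y - x"] by simp
  qed
  ultimately show "x isolated_in L"
    unfolding isolated_in_def using x by (intro conjI exI[of _ ?T]) auto
qed

text \<open>
  A positive linear relation between coordinates that are at least \<open>-1\<close> bounds each of them above.
\<close>
lemma bounded_if_positive_relation:
  fixes X :: "(real ^ 'k::finite) set"
  assumes pos: "\<And>i. u $ i > 0"
    and rel: "\<And>x. x \<in> X \<Longrightarrow> u \<bullet> x = 0"
    and ge: "\<And>x i. x \<in> X \<Longrightarrow> x $ i \<ge> -1"
  shows "bounded X"
proof (rule bounded_subset)
  let ?b = "\<chi> i. (\<Sum>l\<in>UNIV. u $ l) / u $ i"
  show "bounded (cbox (\<chi> i. -1) ?b)"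
    by (rule bounded_cbox)
  have "x $ i \<le> (\<Sum>l\<in>UNIV. u $ l) / u $ i" if x: "x \<in> X" for x i
  proof -
    have "u $ i * (x $ i + 1) \<le> (\<Sum>l\<in>UNIV. u $ l * (x $ l + 1))"
    proof (rule member_le_sum)
      fix l
      show "0 \<le> u $ l * (x $ l + 1)"
        using pos[of l] ge[OF x, of l] by simp
    qed auto
    also have "\<dots> = u \<bullet> x + (\<Sum>l\<in>UNIV. u $ l)"
      by (simp add: inner_vec_def distrib_left sum.distrib)
    finally have "u $ i * x $ i \<le> (\<Sum>l\<in>UNIV. u $ l)"
      using rel[OF x] pos[of i] by (simp add: distrib_left)
    then show ?thesis
      using pos[of i] by (simp add: pos_le_divide_eq mult.commute)
  qed
  then show "X \<subseteq> cbox (\<chi> i. -1) ?b"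
    using ge by (auto simp: mem_box_cart)
qed

section \<open>Vertices and pairings\<close>

lemma convex_hull_vertices:
  fixes P :: "'a::euclidean_space set"
  assumes "polytope P"
  shows "convex hull (vertices P) = P"
  using Krein_Milman_Minkowski[of P] assms
  by (simp add: vertices_def polytope_imp_compact polytope_imp_convex)

lemma span_vertices:
  fixes P :: "'a::euclidean_space set"
  assumes "polytope P" "aff_dim P = int DIM('a)"
  shows "span (vertices P) = UNIV"
proof -
  have "affine hull P = UNIV"
    using assms(2) aff_dim_eq_full by blast
  moreover have "affine hull P = affine hull (vertices P)"
    by (metis affine_hull_convex_hull assms(1) convex_hull_vertices)
  ultimately show ?thesis
    using affine_hull_subset_span[of "vertices P"] by blast
qed

lemma vertex_map_nth [simp]: "vertex_map p V X $ i = p (V i) X"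
  by (simp add: vertex_map_def)

lemma weight_space_conv_inner:
  "weight_space m q = {x. \<forall>j\<in>{1..m}. (\<chi> i. q i j) \<bullet> x = 0}"
  by (simp add: weight_space_def inner_vec_def)

lemma dual_pairing_representation:
  fixes p :: "'a::euclidean_space \<Rightarrow> 'b::euclidean_space \<Rightarrow> real"
  assumes "dual_pairing p" "linear f"
  obtains X where "\<And>y. p y X = f y"
proof -
  have "f \<in> (\<lambda>x y. p y x) ` UNIV"
    using assms unfolding dual_pairing_def bij_betw_def by blast
  then show thesis
    using that by auto
qed

lemma dual_pairing_eq_0I:
  fixes p :: "'a::euclidean_space \<Rightarrow> 'b::euclidean_space \<Rightarrow> real"
  assumes p: "dual_pairing p" and "span B = UNIV" and "\<And>y. y \<in> B \<Longrightarrow> p y X = 0"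
  shows "X = 0"
proof -
  have bil: "bilinear p" and inj: "inj (\<lambda>x y. p y x)"
    using p by (auto simp: dual_pairing_def bij_betw_def)
  have "linear (\<lambda>y. p y X)"
    using bil by (simp add: bilinear_def)
  then have "p y X = 0" for y
    using linear_eq_0_on_span[of "\<lambda>y. p y X" B y] assms by auto
  then have "(\<lambda>y. p y X) = (\<lambda>y. p y 0)"
    using bilinear_rzero[OF bil] by auto
  then show ?thesis
    using inj by (auto dest: injD)
qed

text \<open>A nonzero \<open>y\<close> is not annihilated by the functional that sends \<open>v\<close> to \<open>v \<bullet> y\<close>.\<close>
lemma dual_pairing_eq_0I':
  fixes p :: "'a::euclidean_space \<Rightarrow> 'b::euclidean_space \<Rightarrow> real"
  assumes p: "dual_pairing p" and "span B = UNIV" and "\<And>X. X \<in> B \<Longrightarrow> p y X = 0"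
  shows "y = 0"
proof -
  have "linear (p y)"
    using p by (auto simp: dual_pairing_def bilinear_def)
  then have zero: "p y X = 0" for X
    using linear_eq_0_on_span[of "p y" B X] assms by auto
  have "linear (\<lambda>v. v \<bullet> y)"
    by (intro linearI) (auto simp: inner_add_left)
  then obtain X where "\<And>v. p v X = v \<bullet> y"
    using dual_pairing_representation[OF p] by blast
  then show ?thesis
    using zero[of X] by simp
qed

lemma pairing_ge_on_convex_hull:
  assumes "bilinear p" "\<And>v. v \<in> A \<Longrightarrow> p v X \<ge> c" "y \<in> convex hull A"
  shows "p y X \<ge> (c :: real)"
proof -
  have "linear (\<lambda>y. p y X)"
    using assms(1) by (simp add: bilinear_def)
  then have "convex ((\<lambda>y. p y X) -` {c..})"
    by (intro convex_linear_vimage) auto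
  then have "convex hull A \<subseteq> (\<lambda>y. p y X) -` {c..}"
    using assms(2) by (intro hull_minimal) auto
  then show ?thesis
    using assms(3) by auto
qed

lemma pairing_integral_on_group_closure:
  assumes "bilinear p" "\<And>v. v \<in> A \<Longrightarrow> p v X \<in> \<int>" "y \<in> group_closure A"
  shows "(p y X :: real) \<in> \<int>"
  using assms(3)
  by induction (use assms in \<open>auto simp: bilinear_lzero bilinear_lsub\<close>)

section \<open>The structure of the vertex map\<close>

theorem lemma4:
  fixes p :: "'a::euclidean_space \<Rightarrow> 'b::euclidean_space \<Rightarrow> real"
    and P :: "'a set"
    and V :: "'k::finite \<Rightarrow> 'a"
    and S :: "nat \<Rightarrow> 'a set"
    and q :: "'k \<Rightarrow> nat \<Rightarrow> real"
    and m :: nat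
  assumes "dual_pairing p"
    and "minimal_polytope P"
    and "aff_dim P = int DIM('a)"
    and "bij_betw V UNIV (vertices P)"
    and "m = CARD('k) - DIM('a)"
    and "IP_simplex_structure P S"
    and "combined_weight_system V S m q"
  shows "(linear (vertex_map p V) \<and> inj (vertex_map p V) \<and>
      range (vertex_map p V) = weight_space m q) \<and>
    (bij_betw (vertex_map p V) (dual_polytope p P)
        {x \<in> weight_space m q. \<forall>i. x $ i \<ge> -1} \<and>
      polytope {x \<in> weight_space m q. \<forall>i. x $ i \<ge> -1}) \<and>
    ((\<forall>j\<in>{1..m}. \<forall>i. q i j \<in> \<rat>) \<longrightarrow>
      is_lattice (N_coarsest P) \<and> is_lattice (M_finest p P) \<and>
      bij_betw (vertex_map p V) (M_finest p P)
        {x \<in> weight_space m q. \<forall>i. x $ i \<in> \<int>})"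
proof -
  let ?v = "vertex_map p V" and ?w = "\<lambda>j. \<chi> i. q i j"
  let ?D = "{x \<in> weight_space m q. \<forall>i. x $ i \<ge> -1}"
  have bil: "bilinear p"
    using assms(1) by (simp add: dual_pairing_def)
  have lin_right: "linear (p y)" and lin_left: "linear (\<lambda>y. p y X)" for y X
    using bil by (auto simp: bilinear_def)
  have poly: "polytope P"
    using assms(2) by (simp add: minimal_polytope_def IP_def)
  have vert: "vertices P = range V"
    using assms(4) by (simp add: bij_betw_def)
  have spanV: "span (range V) = UNIV"
    using span_vertices[OF poly assms(3)] vert by simp
  have "card (vertices P) = CARD('k)"
    using bij_betw_same_card[OF assms(4)] by simp
  then have count: "simplex_count P = m"
    using assms(3,5) by (simp add: simplex_count_def)
  have S_sub: "S j \<subseteq> range V" and S_new: "card (S j - (\<Union>i\<in>{1..<j}. S i)) \<ge> 2"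
    if "j \<in> {1..m}" for j
    using assms(6) that unfolding IP_simplex_structure_def count vert by blast+
  have S_hull: "convex hull (\<Union>j\<in>{1..m}. S j) = P"
    using assms(6) unfolding IP_simplex_structure_def count by blast
  have q_pos: "q i j > 0" if "j \<in> {1..m}" "V i \<in> S j" for i j
    using assms(7) that unfolding combined_weight_system_def by blast
  have q_0: "q i j = 0" if "j \<in> {1..m}" "V i \<notin> S j" for i j
    using assms(7) that unfolding combined_weight_system_def by blast
  have q_rel: "(\<Sum>i\<in>UNIV. q i j *\<^sub>R V i) = 0" if "j \<in> {1..m}" for j
    using assms(7) that unfolding combined_weight_system_def by blast

  have echelon: "\<forall>j\<in>{1..m}. \<exists>i. ?w j $ i \<noteq> 0 \<and> (\<forall>l\<in>{1..<j}. ?w l $ i = 0)"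
  proof
    fix j assume j: "j \<in> {1..m}"
    have "S j - (\<Union>i\<in>{1..<j}. S i) \<noteq> {}"
      using S_new[OF j] by (metis card.empty not_numeral_le_zero)
    then obtain i where i: "V i \<in> S j" "\<forall>l\<in>{1..<j}. V i \<notin> S l"
      using S_sub[OF j] by blast
    have "\<forall>l\<in>{1..<j}. q i l = 0"
      using i(2) j by (auto intro!: q_0)
    then show "\<exists>i. ?w j $ i \<noteq> 0 \<and> (\<forall>l\<in>{1..<j}. ?w l $ i = 0)"
      using q_pos[OF j i(1)] by (intro exI[of _ i]) auto
  qed
  \<comment> \<open>The inner product serves as an auxiliary pairing, which \<open>p\<close> then represents; this avoids
    computing the dimension of \<open>M\<close>.\<close>
  have range_inner: "range (\<lambda>y. \<chi> i. V i \<bullet> y) = weight_space m q"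
    using range_evaluation_map[OF spanV _ echelon assms(5)] q_rel
    by (simp add: weight_space_conv_inner)

  have lin: "linear ?v"
    by (intro linearI)
      (auto simp: vec_eq_iff bilinear_radd[OF bil] bilinear_rmul[OF bil])
  have "X = 0" if "?v X = 0" for X
  proof (rule dual_pairing_eq_0I[OF assms(1) spanV])
    fix y assume "y \<in> range V"
    then obtain i where "y = V i" ..
    then show "p y X = 0"
      using that by (metis vertex_map_nth zero_index)
  qed
  then have inj: "inj ?v"
    using lin linear_injective_0 by blast
  have range_v: "range ?v = weight_space m q"
  proof
    show "range ?v \<subseteq> weight_space m q"
    proof
      fix x assume "x \<in> range ?v"
      then obtain X where X: "x = ?v X" ..
      have "(\<Sum>i\<in>UNIV. q i j * x $ i) = 0" if "j \<in> {1..m}" for j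
      proof -
        have "(\<Sum>i\<in>UNIV. q i j * x $ i) = p (\<Sum>i\<in>UNIV. q i j *\<^sub>R V i) X"
          using X by (simp add: linear_sum[OF lin_left] linear_cmul[OF lin_left])
        then show ?thesis
          using q_rel[OF that] bilinear_lzero[OF bil] by simp
      qed
      then show "x \<in> weight_space m q"
        by (simp add: weight_space_def)
    qed
    show "weight_space m q \<subseteq> range ?v"
    proof
      fix x assume "x \<in> weight_space m q"
      then obtain y where y: "x = (\<chi> i. V i \<bullet> y)"
        using range_inner by blast
      have "linear (\<lambda>v. v \<bullet> y)"
        by (intro linearI) (auto simp: inner_add_left)
      then obtain X where "\<And>v. p v X = v \<bullet> y"
        using dual_pairing_representation[OF assms(1)] by blast
      then have "x = ?v X"
        using y by (simp add: vec_eq_iff)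
      then show "x \<in> range ?v"
        by blast
    qed
  qed
  have bij: "bij_betw ?v A {x \<in> weight_space m q. Q x}"
    if "\<And>X. X \<in> A \<longleftrightarrow> Q (?v X)" for A Q
  proof -
    have "?v ` A = {x \<in> range ?v. Q x}"
      using that by auto
    then show ?thesis
      using inj range_v inj_on_subset[of ?v UNIV A] by (simp add: bij_betw_def)
  qed

  have "X \<in> dual_polytope p P \<longleftrightarrow> (\<forall>i. ?v X $ i \<ge> -1)" for X
  proof
    assume "X \<in> dual_polytope p P"
    moreover have "V i \<in> P" for i
      using vert unfolding vertices_def extreme_point_of_def by blast
    ultimately show "\<forall>i. ?v X $ i \<ge> -1"
      by (simp add: dual_polytope_def)
  next
    assume "\<forall>i. ?v X $ i \<ge> -1"
    then have "p v X \<ge> -1" if "v \<in> range V" for v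
      using that by auto
    then have "p y X \<ge> -1" if "y \<in> convex hull (range V)" for y
      using pairing_ge_on_convex_hull[OF bil _ that] by blast
    then show "X \<in> dual_polytope p P"
      using convex_hull_vertices[OF poly] vert by (simp add: dual_polytope_def)
  qed
  then have bij_dual: "bij_betw ?v (dual_polytope p P) ?D"
    by (rule bij)

  have poly_D: "polytope ?D"
  proof -
    let ?u = "\<chi> i. \<Sum>j\<in>{1..m}. q i j"
    have "?u $ i > 0" for i
    proof -
      \<comment> \<open>Every vertex lies in some simplex, as the simplices generate the polytope.\<close>
      have "V i extreme_point_of (convex hull (\<Union>j\<in>{1..m}. S j))"
        using vert S_hull by (auto simp: vertices_def)
      then have "V i \<in> (\<Union>j\<in>{1..m}. S j)"
        by (rule extreme_point_of_convex_hull)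
      then obtain j where j: "j \<in> {1..m}" "V i \<in> S j"
        by blast
      have "q i l \<ge> 0" if "l \<in> {1..m}" for l
        using q_pos[OF that, of i] q_0[OF that, of i] by fastforce
      then have "(\<Sum>l\<in>{1..m}. q i l) > 0"
        using sum_pos2[of "{1..m}" j "q i"] j q_pos by simp
      then show ?thesis by simp
    qed
    moreover have "?u \<bullet> x = 0" if "x \<in> ?D" for x
    proof -
      have "?u \<bullet> x = (\<Sum>j\<in>{1..m}. \<Sum>i\<in>UNIV. q i j * x $ i)"
        by (simp add: inner_vec_def sum_distrib_right sum.swap[of _ UNIV])
      then show ?thesis
        using that by (simp add: weight_space_def)
    qed
    ultimately have "bounded ?D"
      by (rule bounded_if_positive_relation) auto
    moreover have "?D = (\<Inter>j\<in>{1..m}. {x. ?w j \<bullet> x = 0}) \<inter> (\<Inter>i\<in>UNIV. {x. axis i 1 \<bullet> x \<ge> -1})"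
      by (auto simp: weight_space_conv_inner inner_axis')
    then have "polyhedron ?D"
      by (auto intro!: polyhedron_Int polyhedron_Inter polyhedron_hyperplane polyhedron_halfspace_ge)
    ultimately show ?thesis
      by (simp add: polytope_eq_bounded_polyhedron)
  qed

  have mem_M: "X \<in> M_finest p P \<longleftrightarrow> (\<forall>i. ?v X $ i \<in> \<int>)" for X
  proof
    assume "X \<in> M_finest p P"
    then show "\<forall>i. ?v X $ i \<in> \<int>"
      using vert by (auto simp: M_finest_def N_coarsest_def intro: group_closure.base)
  next
    assume "\<forall>i. ?v X $ i \<in> \<int>"
    then have "p v X \<in> \<int>" if "v \<in> range V" for v
      using that by auto
    then have "p y X \<in> \<int>" if "y \<in> group_closure (range V)" for y
      using pairing_integral_on_group_closure[OF bil _ that] by blast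
    then show "X \<in> M_finest p P"
      using vert by (simp add: M_finest_def N_coarsest_def)
  qed
  then have bij_M: "bij_betw ?v (M_finest p P) {x \<in> weight_space m q. \<forall>i. x $ i \<in> \<int>}"
    by (rule bij)

  have lattices: "is_lattice (N_coarsest P) \<and> is_lattice (M_finest p P)"
    if rat: "\<forall>j\<in>{1..m}. \<forall>i. q i j \<in> \<rat>"
  proof -
    have spanM: "span (M_finest p P) = UNIV"
    proof -
      have "?v X \<in> ?v ` span (M_finest p P)" for X
      proof -
        have "weight_space m q \<subseteq> span {x \<in> weight_space m q. \<forall>i. x $ i \<in> \<int>}"
          using span_integral_solutions[of m ?w] rat by (simp add: weight_space_conv_inner)
        then have "range ?v \<subseteq> span (?v ` M_finest p P)"
          using bij_M range_v by (simp add: bij_betw_def)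
        then show ?thesis
          using linear_span_image[OF lin] by auto
      qed
      then show ?thesis
        using inj by (auto simp: inj_image_mem_iff)
    qed
    then obtain B where B: "B \<subseteq> M_finest p P" "finite B" "span B = UNIV"
      using maximal_independent_subset[of "M_finest p P"]
      by (metis finiteI_independent span_mono span_span top.extremum_uniqueI)
    have N: "p y X \<in> \<int>" if "y \<in> N_coarsest P" "X \<in> M_finest p P" for y X
      using that by (simp add: M_finest_def)
    have V_N: "range V \<subseteq> N_coarsest P"
      using vert by (auto simp: N_coarsest_def intro: group_closure.base)
    have "discrete (N_coarsest P)"
    proof (rule discrete_if_integral[of "(\<lambda>X y. p y X) ` B"])
      show "y = 0" if "\<And>f. f \<in> (\<lambda>X y. p y X) ` B \<Longrightarrow> f y = 0" for y
        by (rule dual_pairing_eq_0I'[OF assms(1) B(3)]) (use that in auto)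
    qed (use B N lin_left in auto)
    moreover have "span (N_coarsest P) = UNIV"
      using span_mono[OF V_N] spanV by auto
    moreover have "discrete (M_finest p P)"
    proof (rule discrete_if_integral[of "p ` range V"])
      show "X = 0" if "\<And>f. f \<in> p ` range V \<Longrightarrow> f X = 0" for X
        by (rule dual_pairing_eq_0I[OF assms(1) spanV]) (use that in auto)
    qed (use V_N N lin_right in auto)
    ultimately show ?thesis
      using spanM
      by (auto simp: is_lattice_def N_coarsest_def M_finest_def bilinear_rzero[OF bil]
          bilinear_rsub[OF bil] intro: group_closure.diff)
  qed

  show ?thesis
    using lin inj range_v bij_dual poly_D lattices bij_M by blast
qed

end
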